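(* Let $0<s<1$ and, for $n\ge1$, let $$\mathfrak g_n^0(z):=(1-z)^s\sum_{j=0}^{n-1}k^s(j)z^j,\qquad |z|\le1.$$ Then for every $\alpha$ with $0\le\alpha<1-s$ one has: (i) there is $M>0$, independent of $n$, such that $\|\mathfrak g_n^0\|_{A^\alpha(\mathbb D)}\le M$ for every $n\ge1$; (ii) $\lim_{n\to\infty}(1-z)\mathfrak g_n^0(z)=1-z$ in $A^\alpha(\mathbb D)$.
   Context: For $\alpha\in\mathbb R$: $k^\alpha(0)=1$, $k^\alpha(n)=\frac{\alpha(\alpha+1)\cdots(\alpha+n-1)}{n!}$ for $n\ge1$ (coefficients of $(1-z)^{-\alpha}$). For $\alpha\ge0$ put $W^{-\alpha}f(n)=\sum_{j=n}^\infty k^{\alpha}(j-n)f(j)$. $A^\alpha(\mathbb D)$ is the Banach algebra of functions $\mathfrak h(z)=\sum_{n\ge0} h(n)z^n$ with $h\in\ell^1$ such that $h=W^{-\alpha}u$ for some (unique) sequence $u$ with $\sum_n|u(n)|k^{\alpha+1}(n)<\infty$; one writes $u=W^\alpha h$ (it equals $D^\alpha h(n)=\sum_{j\ge n}k^{-\alpha}(j-n)h(j)$), and the norm is $\|\mathfrak h\|_{A^\alpha(\mathbb D)}=\sum_n|W^\alpha h(n)|k^{\alpha+1}(n)$. *)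

theory Defs
  imports "HOL-Complex_Analysis.Complex_Analysis"
begin

definition cesaro_num :: "real \<Rightarrow> nat \<Rightarrow> real" where
  "cesaro_num \<alpha> n = pochhammer \<alpha> n / fact n"

text \<open>The sum over \<open>j \<ge> n\<close> of \<open>k\<^sup>\<alpha>(j - n) f(j)\<close>, re-indexed by \<open>j - n\<close>. It is only used for
  \<open>f\<close> satisfying the weighted summability condition of \<open>is_Weyl_diff\<close>, which makes the series
  absolutely convergent.\<close>

definition Weyl_sum :: "real \<Rightarrow> (nat \<Rightarrow> complex) \<Rightarrow> nat \<Rightarrow> complex" where
  "Weyl_sum \<alpha> f n = (\<Sum>j. of_real (cesaro_num \<alpha> j) * f (n + j))"

definition is_Weyl_diff :: "real \<Rightarrow> (nat \<Rightarrow> complex) \<Rightarrow> (nat \<Rightarrow> complex) \<Rightarrow> bool" where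
  "is_Weyl_diff \<alpha> h u \<longleftrightarrow>
     summable (\<lambda>n. norm (u n) * cesaro_num (\<alpha> + 1) n) \<and> h = Weyl_sum \<alpha> u"

definition Weyl_diff :: "real \<Rightarrow> (nat \<Rightarrow> complex) \<Rightarrow> nat \<Rightarrow> complex" where
  "Weyl_diff \<alpha> h = (THE u. is_Weyl_diff \<alpha> h u)"

definition is_disc_coeffs :: "(complex \<Rightarrow> complex) \<Rightarrow> (nat \<Rightarrow> complex) \<Rightarrow> bool" where
  "is_disc_coeffs H h \<longleftrightarrow>
     summable (\<lambda>n. norm (h n)) \<and> (\<forall>z. norm z \<le> 1 \<longrightarrow> (\<lambda>n. h n * z ^ n) sums H z)"

definition disc_coeffs :: "(complex \<Rightarrow> complex) \<Rightarrow> nat \<Rightarrow> complex" where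
  "disc_coeffs H = (THE h. is_disc_coeffs H h)"

text \<open>Functions on the closed unit disc are represented by functions on \<open>\<complex>\<close> whose values
  outside the disc are irrelevant.\<close>

definition A_disc :: "real \<Rightarrow> (complex \<Rightarrow> complex) set" where
  "A_disc \<alpha> = {H. \<exists>h u. is_disc_coeffs H h \<and> is_Weyl_diff \<alpha> h u}"

definition A_norm :: "real \<Rightarrow> (complex \<Rightarrow> complex) \<Rightarrow> real" where
  "A_norm \<alpha> H = (\<Sum>n. norm (Weyl_diff \<alpha> (disc_coeffs H) n) * cesaro_num (\<alpha> + 1) n)"

text \<open>The power is the principal branch, with value \<open>0\<close> at \<open>z = 1\<close>.\<close>

definition g0 :: "real \<Rightarrow> nat \<Rightarrow> complex \<Rightarrow> complex" where
  "g0 s n z = (1 - z) powr of_real s * (\<Sum>j<n. of_real (cesaro_num s j) * z ^ j)"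

end

theory Submission
  imports Defs "HOL-Real_Asymp.Real_Asymp"
begin

text \<open>
  The coefficient of \<open>z\<^sup>m\<close> in \<open>1 - g\<^sub>n\<close> vanishes for \<open>m < n\<close> and telescopes to
  \<open>r(m) = (s / m) k\<^bsup>1+s\<^esup>(n-1) k\<^bsup>1-s\<^esup>(m-n)\<close> for \<open>m \<ge> n\<close>, a positive, decreasing, convex
  sequence of total mass \<open>1\<close>. Since \<open>k\<^bsup>-\<alpha>\<^esup>(j) \<le> 0\<close> for \<open>j \<ge> 1\<close> and \<open>\<Sum>\<^sub>j k\<^bsup>-\<alpha>\<^esup>(j) \<ge> 0\<close>,
  the fractional difference \<open>U = D\<^sup>\<alpha> r\<close> is negative before \<open>n\<close> and positive from \<open>n\<close> on, while
  \<open>\<Sum> U k\<^bsup>\<alpha>+1\<^esup> = \<Sum> r = 1\<close>. So the norm is controlled by the part of the sum below \<open>n\<close>, which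
  the same closed form (with \<open>\<alpha>\<close> in place of \<open>s\<close>) and the comparison of
  \<open>k\<^bsup>1\<plusminus>s\<^esup> k\<^bsup>1\<plusminus>\<alpha>\<^esup>\<close> with \<open>k\<^bsup>1\<plusminus>(s+\<alpha>)\<^esup>\<close> bound by a multiple of the total mass of the sequence
  \<open>r\<close> for the parameter \<open>s + \<alpha> < 1\<close>.

  For the limit, convexity of \<open>r\<close> makes \<open>U\<close> monotone on either side of \<open>n\<close>. Summation by parts
  then bounds the norm of \<open>(1 - z)(1 - g\<^sub>n)\<close> by the jump at \<open>n\<close>, of order
  \<open>k\<^bsup>\<alpha>+1\<^esup>(n) k\<^sup>s(n)\<close>, which is \<open>O(n\<^bsup>s+\<alpha>-1\<^esup>)\<close>, plus \<open>1/n\<close> times the norm of \<open>1 - g\<^sub>n\<close>.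
\<close>

section \<open>Cesaro numbers\<close>

lemma cesaro_num_0 [simp]: "cesaro_num a 0 = 1"
  by (simp add: cesaro_num_def)

lemma cesaro_num_Suc: "cesaro_num a (Suc n) = cesaro_num a n * (a + real n) / (real n + 1)"
  by (simp add: cesaro_num_def pochhammer_rec' divide_simps)

lemma cesaro_num_Suc_shift: "cesaro_num a (Suc n) = a * cesaro_num (1 + a) n / (real n + 1)"
  by (simp add: cesaro_num_def pochhammer_rec divide_simps) (simp add: algebra_simps)

lemma cesaro_num_shift: "a * cesaro_num (1 + a) n = (a + real n) * cesaro_num a n"
  using cesaro_num_Suc[of a n] cesaro_num_Suc_shift[of a n] by (simp add: field_simps)

lemma cesaro_num_add_Suc:
  "cesaro_num (1 + a) (Suc n) = cesaro_num (1 + a) n + cesaro_num a (Suc n)"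
  unfolding cesaro_num_Suc[of "1 + a"] cesaro_num_Suc_shift[of a] by (simp add: field_simps)

lemma cesaro_num_sum: "(\<Sum>i\<le>n. cesaro_num a i) = cesaro_num (1 + a) n"
  by (induction n) (simp_all add: cesaro_num_add_Suc)

lemma cesaro_num_conv:
  "(\<Sum>i\<le>n. cesaro_num a i * cesaro_num b (n - i)) = cesaro_num (a + b) n"
  unfolding cesaro_num_def pochhammer_binomial_sum sum_divide_distrib
  by (intro sum.cong) (simp_all add: binomial_fact)

lemma cesaro_num_zero: "cesaro_num 0 n = (if n = 0 then 1 else 0)"
  by (simp add: cesaro_num_def pochhammer_0_left)

lemma cesaro_num_one: "cesaro_num 1 n = 1"
  by (simp add: cesaro_num_def pochhammer_fact[symmetric])

lemma cesaro_num_pos: "0 < a \<Longrightarrow> 0 < cesaro_num a n"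
  by (simp add: cesaro_num_def pochhammer_pos)

lemma cesaro_num_nonneg: "0 \<le> a \<Longrightarrow> 0 \<le> cesaro_num a n"
  using cesaro_num_pos[of a n] by (cases "a = 0") (auto simp: cesaro_num_zero)

lemma cesaro_num_uminus_nonpos:
  assumes "0 \<le> a" "a \<le> 1" "0 < n"
  shows "cesaro_num (- a) n \<le> 0"
proof -
  obtain m where n: "n = Suc m" using assms(3) gr0_implies_Suc by blast
  show ?thesis
    unfolding n cesaro_num_Suc_shift using assms cesaro_num_nonneg[of "1 - a" m]
    by (simp add: divide_simps)
qed

text \<open>The ratio of consecutive terms is (n - a) / (n + 1), and the terms are nonpositive, so
  they climb towards 0. Index 0 is excluded because the sequence first drops from 1 to -a.\<close>

lemma cesaro_num_uminus_mono:
  assumes "0 \<le> a" "a \<le> 1" "0 < n"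
  shows "cesaro_num (- a) n \<le> cesaro_num (- a) (Suc n)"
proof -
  have "cesaro_num (- a) (Suc n) - cesaro_num (- a) n
      = (- cesaro_num (- a) n) * (1 + a) / (real n + 1)"
    by (simp add: cesaro_num_Suc field_simps)
  moreover have "(- cesaro_num (- a) n) * (1 + a) / (real n + 1) \<ge> 0"
    using cesaro_num_uminus_nonpos[OF assms] assms by (intro divide_nonneg_pos mult_nonneg_nonneg) auto
  ultimately show ?thesis by linarith
qed

lemma cesaro_num_decseq:
  assumes "0 \<le> a" "a \<le> 1"
  shows "cesaro_num a (Suc n) \<le> cesaro_num a n"
  using mult_left_mono[of "(a + real n) / (real n + 1)" 1 "cesaro_num a n"]
    cesaro_num_nonneg[of a n] assms
  by (simp add: cesaro_num_Suc)

text \<open>The backward difference of k^a is k^(a-1), so convexity is the monotonicity of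
  k^(-(1-a)) at positive indices.\<close>

lemma cesaro_num_convex:
  assumes "0 \<le> a" "a \<le> 1"
  shows "cesaro_num a (Suc n) - cesaro_num a (Suc (Suc n)) \<le> cesaro_num a n - cesaro_num a (Suc n)"
  using cesaro_num_add_Suc[of "a - 1" n] cesaro_num_add_Suc[of "a - 1" "Suc n"]
    cesaro_num_uminus_mono[of "1 - a" "Suc n"] assms by simp

lemma cesaro_num_incseq: "0 \<le> a \<Longrightarrow> incseq (cesaro_num (1 + a))"
  by (intro incseq_SucI) (simp add: cesaro_num_add_Suc cesaro_num_nonneg)

lemma cesaro_num_ge_one: "0 \<le> a \<Longrightarrow> 1 \<le> cesaro_num (1 + a) n"
  using incseqD[OF cesaro_num_incseq, of a 0 n] by simp

lemma abs_cesaro_num_le_one: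
  assumes "\<bar>a\<bar> \<le> 1"
  shows "\<bar>cesaro_num a n\<bar> \<le> 1"
proof (induction n)
  case (Suc n)
  have "\<bar>a + real n\<bar> / (real n + 1) \<le> 1"
    using assms by (simp add: divide_simps)
  then have "\<bar>cesaro_num a n\<bar> * (\<bar>a + real n\<bar> / (real n + 1)) \<le> 1 * 1"
    using Suc by (intro mult_mono) auto
  then show ?case by (simp add: cesaro_num_Suc abs_mult)
qed simp

text \<open>Only the term at 0, which is 1, is positive. Hence the absolute sum is 2 minus the plain
  sum, and the plain sum is k^(1-a)(n), which is nonnegative.\<close>

lemma sum_abs_cesaro_num_uminus:
  assumes "0 \<le> a" "a \<le> 1"
  shows "(\<Sum>i\<le>n. \<bar>cesaro_num (- a) i\<bar>) \<le> 2"
proof -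
  have "(\<Sum>i\<le>n. \<bar>cesaro_num (- a) i\<bar>) = (\<Sum>i\<le>n. 2 * (if i = 0 then 1 else 0) - cesaro_num (- a) i)"
    using cesaro_num_uminus_nonpos[OF assms] by (intro sum.cong) auto
  also have "\<dots> = 2 - cesaro_num (1 - a) n"
    by (simp add: sum_subtractf cesaro_num_sum flip: sum_distrib_left)
  finally show ?thesis using cesaro_num_nonneg[of "1 - a" n] assms by simp
qed

lemma summable_abs_cesaro_num_uminus:
  assumes "0 \<le> a" "a \<le> 1"
  shows "summable (\<lambda>i. \<bar>cesaro_num (- a) i\<bar>)"
  by (rule bounded_imp_summable[where B = 2]) (use sum_abs_cesaro_num_uminus[OF assms] in auto)

text \<open>Over all j up to m the convolution is k^0(m) = 0; this is its truncation after j = n.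
  The closed form serves twice: for the coefficients of 1 - g_n, and with a in place of s for the
  weights in \<open>conv_weight_ge\<close>.\<close>

lemma cesaro_num_partial_conv:
  assumes "n < m"
  shows "(\<Sum>j<Suc n. cesaro_num s j * cesaro_num (- s) (m - j))
       = - (s / real m * cesaro_num (1 + s) n * cesaro_num (1 - s) (m - Suc n))"
  using assms
proof (induction n)
  case 0
  then obtain l where "m = Suc l" using gr0_implies_Suc by blast
  then show ?case by (simp add: cesaro_num_Suc_shift add.commute)
next
  case (Suc n)
  define i where "i = m - Suc (Suc n)"
  have m: "m = Suc (Suc (n + i))" using Suc.prems by (simp add: i_def)
  define A where "A = cesaro_num (1 + s) n"
  define B where "B = cesaro_num (1 - s) i"
  have "(\<Sum>j<Suc (Suc n). cesaro_num s j * cesaro_num (- s) (m - j))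
      = - (s / real m * A * (B * (1 - s + i) / (i + 1))) + s * A / (n + 1) * (- s * B / (i + 1))"
    using Suc by (subst sum.lessThan_Suc)
      (simp add: m A_def B_def cesaro_num_Suc_shift[of s n] cesaro_num_Suc_shift[of "- s" i]
        cesaro_num_Suc[of "1 - s" i] add.commute)
  \<comment> \<open>Since m = n + i + 2, this reduces to (n + 1)(1 - s + i) + s m = (i + 1)(1 + s +
    n).\<close>
  also have "\<dots> = - (s / real m * (A * (1 + s + n) / (n + 1)) * B)"
    by (simp add: m divide_simps) (simp add: algebra_simps)
  finally show ?case by (simp add: A_def B_def i_def cesaro_num_Suc[of "1 + s" n])
qed

section \<open>Growth of Cesaro numbers through the Gamma function\<close>

lemma cesaro_num_eq_rGamma_series:
  assumes "0 < a" "0 < n"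
  shows "cesaro_num a n = rGamma_series a n * real n powr a / (a + real n)"
  using assms
  by (simp add: cesaro_num_def rGamma_series_def pochhammer_rec' powr_def)

text \<open>Since k^a(n) is asymptotic to n^(a-1) / Gamma(a), both sides have order n^(a+b-2). The
  quotient converges and is therefore bounded.\<close>

lemma cesaro_num_mult_le:
  assumes "0 < a" "0 < b" "1 < a + b"
  shows "\<exists>C>0. \<forall>n. cesaro_num a n * cesaro_num b n \<le> C * cesaro_num (a + b - 1) n"
proof -
  define c where "c = a + b - 1"
  have c: "0 < c" using assms by (simp add: c_def)
  define q where "q n = cesaro_num a n * cesaro_num b n / cesaro_num c n" for n
  have "(\<lambda>n. rGamma_series a n * rGamma_series b n / rGamma_series c n
            * (real n * (c + n) / ((a + n) * (b + n)))) \<longlonglongrightarrow> rGamma a * rGamma b / rGamma c * 1"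
  proof (intro tendsto_intros)
    show "rGamma c \<noteq> 0" using c by (auto simp: rGamma_eq_zero_iff elim!: nonpos_Ints_cases)
    show "(\<lambda>n. real n * (c + n) / ((a + n) * (b + n))) \<longlonglongrightarrow> 1"
      by real_asymp
  qed
  moreover have "\<forall>\<^sub>F n in sequentially. rGamma_series a n * rGamma_series b n / rGamma_series c n
            * (real n * (c + n) / ((a + n) * (b + n))) = q n"
    using eventually_gt_at_top[of 0]
  proof eventually_elim
    case (elim n)
    have pos: "0 < real n powr c" "a + n > 0" "b + n > 0" "c + n > 0" using elim assms c by auto
    \<comment> \<open>Because a + b = c + 1, one factor n is left over; it balances the surplus
      linear factor in the denominator.\<close>
    have "real n powr a * real n powr b = real n * real n powr c"
      using elim by (simp add: c_def powr_diff flip: powr_add)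
    then have "q n * (real n powr c * (a + n) * (b + n)) = rGamma_series a n * rGamma_series b n / rGamma_series c n
            * (real n * (c + n) / ((a + n) * (b + n))) * (real n powr c * (a + n) * (b + n))"
      unfolding q_def cesaro_num_eq_rGamma_series[OF assms(1) elim]
        cesaro_num_eq_rGamma_series[OF assms(2) elim] cesaro_num_eq_rGamma_series[OF c elim]
      using pos by (simp add: divide_simps)
    then show ?case using pos by (subst (asm) mult_right_cancel) auto
  qed
  ultimately have "q \<longlonglongrightarrow> rGamma a * rGamma b / rGamma c * 1"
    by (rule Lim_transform_eventually)
  then have "Bseq q" by (intro convergent_imp_Bseq convergentI)
  then obtain C where C: "C > 0" "\<And>n. norm (q n) \<le> C" by (auto elim: BseqE)
  have "cesaro_num a n * cesaro_num b n \<le> C * cesaro_num c n" for n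
    using C(2)[of n] cesaro_num_pos[OF c, of n] by (auto simp: q_def divide_simps abs_le_iff mult.commute)
  then show ?thesis using C(1) c_def by blast
qed

lemma cesaro_num_tendsto_0:
  assumes "0 < a" "a < 1"
  shows "cesaro_num a \<longlonglongrightarrow> 0"
proof -
  have "(\<lambda>n. rGamma_series a n * (real n powr a / (a + real n))) \<longlonglongrightarrow> rGamma a * 0"
    by (intro tendsto_intros) (use assms in real_asymp)
  moreover have "\<forall>\<^sub>F n in sequentially. rGamma_series a n * (real n powr a / (a + real n)) = cesaro_num a n"
    using eventually_gt_at_top[of 0]
    by eventually_elim (simp add: cesaro_num_eq_rGamma_series assms)
  ultimately show ?thesis by (auto dest: Lim_transform_eventually)
qed

section \<open>Weyl sums and coefficient sequences\<close>

text \<open>The uniform bound that makes the double series in \<open>Weyl_sum_inverse\<close>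
  absolutely summable. Of k^b and k^(-b), the one with nonpositive parameter has total mass at most
  2 and the other is bounded by 1; the reflection i to l - i exchanges them.\<close>

lemma sum_abs_cesaro_num_conv_le:
  assumes "\<bar>b\<bar> \<le> 1"
  shows "(\<Sum>i\<le>l. \<bar>cesaro_num (- b) i * cesaro_num b (l - i)\<bar>) \<le> 2"
proof -
  have *: "(\<Sum>i\<le>l. \<bar>cesaro_num (- a) i * cesaro_num a (l - i)\<bar>) \<le> 2" if a: "0 \<le> a" "a \<le> 1" for a
  proof -
    have "(\<Sum>i\<le>l. \<bar>cesaro_num (- a) i * cesaro_num a (l - i)\<bar>) \<le> (\<Sum>i\<le>l. \<bar>cesaro_num (- a) i\<bar>)"
      using abs_cesaro_num_le_one[of a] a
      by (intro sum_mono) (auto simp: abs_mult intro!: mult_left_le)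
    also have "\<dots> \<le> 2" by (rule sum_abs_cesaro_num_uminus) fact+
    finally show ?thesis .
  qed
  show ?thesis
  proof (cases "0 \<le> b")
    case False
    have "(\<Sum>i\<le>l. \<bar>cesaro_num (- b) i * cesaro_num b (l - i)\<bar>)
        = (\<Sum>i\<le>l. \<bar>cesaro_num b i * cesaro_num (- b) (l - i)\<bar>)"
      by (rule sum.reindex_bij_witness[of _ "\<lambda>i. l - i" "\<lambda>i. l - i"]) (auto simp: mult.commute)
    then show ?thesis using *[of "- b"] assms False by simp
  qed (use * assms in auto)
qed

lemma summable_norm_Weyl_sum_terms:
  fixes f :: "nat \<Rightarrow> complex"
  assumes "\<bar>b\<bar> \<le> 1" "summable (\<lambda>n. norm (f n))"
  shows "summable (\<lambda>j. norm (of_real (cesaro_num b j) * f (n + j)))"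
proof (rule summable_comparison_test')
  show "summable (\<lambda>j. norm (f (n + j)))"
    using assms(2) by (simp add: summable_iff_shift[of "\<lambda>n. norm (f n)" n] add.commute)
  show "norm (norm (of_real (cesaro_num b j) * f (n + j))) \<le> norm (f (n + j))" if "0 \<le> j" for j
    using abs_cesaro_num_le_one[OF assms(1), of j] by (simp add: norm_mult mult_left_le_one_le)
qed

text \<open>Along the diagonals l = i + j the double series has coefficients k^(-b) * k^b = k^0,
  which is 1 at l = 0 and 0 elsewhere. Both signs of b matter: b = a gives uniqueness of the Weyl
  difference, b = -a its existence.\<close>

lemma Weyl_sum_inverse:
  fixes f :: "nat \<Rightarrow> complex"
  assumes b: "\<bar>b\<bar> \<le> 1" and f: "summable (\<lambda>n. norm (f n))"
  shows "Weyl_sum (- b) (Weyl_sum b f) = f"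
proof
  fix n
  define F where "F = (\<lambda>(i, j). of_real (cesaro_num (- b) i) * (of_real (cesaro_num b j) * f (n + i + j)))"
  define G where "G = (\<lambda>(l, i). of_real (cesaro_num (- b) i * cesaro_num b (l - i)) * f (n + l))"
  define S where "S = (SIGMA l:(UNIV :: nat set). {..l})"
  have fn: "summable (\<lambda>l. norm (f (n + l)))"
    using f by (simp add: summable_iff_shift[of "\<lambda>n. norm (f n)" n] add.commute)
  have "(\<lambda>x. norm (G x)) summable_on S"
    unfolding S_def Infinite_Sum.abs_summable_on_Sigma_iff
  proof (intro conjI ballI)
    fix l :: nat
    show "(\<lambda>i. norm (G (l, i))) summable_on {..l}" by simp
  next
    have "summable (\<lambda>l. \<Sum>\<^sub>\<infinity>i\<in>{..l}. norm (G (l, i)))"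
    proof (rule summable_comparison_test')
      show "summable (\<lambda>l. 2 * norm (f (n + l)))" using fn by (rule summable_mult)
      fix l :: nat
      have "(\<Sum>\<^sub>\<infinity>i\<in>{..l}. norm (G (l, i)))
          = (\<Sum>i\<le>l. \<bar>cesaro_num (- b) i * cesaro_num b (l - i)\<bar>) * norm (f (n + l))"
        by (simp add: G_def norm_mult sum_distrib_right abs_mult)
      also have "\<dots> \<le> 2 * norm (f (n + l))"
        using sum_abs_cesaro_num_conv_le[OF b] by (intro mult_right_mono) auto
      finally show "norm (\<Sum>\<^sub>\<infinity>i\<in>{..l}. norm (G (l, i))) \<le> 2 * norm (f (n + l))"
        by (simp add: sum_nonneg)
    qed
    then show "(\<lambda>l. norm (\<Sum>\<^sub>\<infinity>i\<in>{..l}. norm (G (l, i)))) summable_on UNIV"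
      by (simp add: summable_on_UNIV_nonneg_real_iff sum_nonneg)
  qed
  then have GS: "G summable_on S" by (rule abs_summable_summable)
  \<comment> \<open>Diagonal coordinates (l, i) with i at most l correspond to pairs (i, j) with j =
    l - i; summing over j first recovers the inner Weyl sum.\<close>
  have bij: "bij_betw (\<lambda>(l, i). (i, l - i)) S (UNIV \<times> UNIV)"
    by (rule bij_betw_byWitness[where f' = "\<lambda>(i, j). (i + j, i)"]) (auto simp: S_def)
  have FG: "F ((\<lambda>(l, i). (i, l - i)) x) = G x" if "x \<in> S" for x
    using that by (auto simp: S_def F_def G_def)
  have "(G has_sum f n) S"
  proof -
    have GS': "(G has_sum infsum G S) (SIGMA l:UNIV. {..l})"
      using has_sum_infsum[OF GS] by (simp only: S_def)
    have "((\<lambda>l. if l = 0 then f n else 0) has_sum infsum G S) (UNIV :: nat set)"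
    proof (rule has_sum_SigmaD[OF GS'])
      fix l :: nat
      have "(\<Sum>i\<le>l. G (l, i)) = of_real (\<Sum>i\<le>l. cesaro_num (- b) i * cesaro_num b (l - i)) * f (n + l)"
        by (simp add: G_def sum_distrib_right)
      also have "\<dots> = (if l = 0 then f n else 0)"
        by (simp add: cesaro_num_conv cesaro_num_zero)
      finally show "((\<lambda>i. G (l, i)) has_sum (if l = 0 then f n else 0)) {..l}"
        using has_sum_finite[of "{..l}" "\<lambda>i. G (l, i)"] by simp
    qed
    moreover have "((\<lambda>l. if l = 0 then f n else 0) has_sum f n) (UNIV :: nat set)"
      by (rule has_sum_finite_neutralI[of "{0}"]) auto
    ultimately have "infsum G S = f n" by (rule has_sum_unique)
    then show ?thesis using has_sum_infsum[OF GS] by simp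
  qed
  then have "((\<lambda>x. F ((\<lambda>(l, i). (i, l - i)) x)) has_sum f n) S"
    by (rule has_sum_cong[THEN iffD2, rotated]) (rule FG)
  then have F: "(F has_sum f n) (UNIV \<times> UNIV)"
    using has_sum_reindex_bij_betw[OF bij] by blast
  have "((\<lambda>i. of_real (cesaro_num (- b) i) * Weyl_sum b f (n + i)) has_sum f n) UNIV"
  proof (rule has_sum_SigmaD[OF F])
    fix i :: nat
    have "((\<lambda>j. of_real (cesaro_num b j) * f (n + i + j)) has_sum Weyl_sum b f (n + i)) UNIV"
      unfolding Weyl_sum_def using summable_norm_Weyl_sum_terms[OF b f, of "n + i"]
      by (metis norm_summable_imp_has_sum summable_sums summable_norm_cancel)
    then show "((\<lambda>j. F (i, j)) has_sum of_real (cesaro_num (- b) i) * Weyl_sum b f (n + i)) UNIV"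
      unfolding F_def prod.case by (rule has_sum_cmult_right)
  qed
  then show "Weyl_sum (- b) (Weyl_sum b f) n = f n"
    unfolding Weyl_sum_def[of "- b"] by (intro sums_unique[symmetric] has_sum_imp_sums)
qed

lemma summable_norm_of_weighted:
  fixes u :: "nat \<Rightarrow> complex"
  assumes "0 \<le> a" "summable (\<lambda>n. norm (u n) * cesaro_num (a + 1) n)"
  shows "summable (\<lambda>n. norm (u n))"
proof (rule summable_comparison_test'[OF assms(2)])
  show "norm (norm (u n)) \<le> norm (u n) * cesaro_num (a + 1) n" if "0 \<le> n" for n
    using cesaro_num_ge_one[OF assms(1), of n] by (simp add: add.commute mult_le_cancel_left1)
qed

text \<open>Resolves the definite description: by inversion every candidate must be
  \<open>Weyl_sum (- a) h\<close>. The weight k^(a+1) is at least 1, so candidates are absolutely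
  summable.\<close>

lemma Weyl_diff_eqI:
  assumes "0 \<le> a" "a \<le> 1" "is_Weyl_diff a h u"
  shows "Weyl_diff a h = u"
proof -
  have "v = Weyl_sum (- a) h" if "is_Weyl_diff a h v" for v
    using that assms(1,2) Weyl_sum_inverse[of a v] summable_norm_of_weighted[of a v]
    by (simp add: is_Weyl_diff_def)
  then show ?thesis unfolding Weyl_diff_def using assms(3) by (metis the_equality)
qed

lemma is_Weyl_diff_Weyl_sum_uminus:
  assumes "0 \<le> a" "a \<le> 1" "summable (\<lambda>n. norm (h n))"
    and "summable (\<lambda>n. norm (Weyl_sum (- a) h n) * cesaro_num (a + 1) n)"
  shows "is_Weyl_diff a h (Weyl_sum (- a) h)"
  using assms Weyl_sum_inverse[of "- a" h] by (simp add: is_Weyl_diff_def)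

section \<open>Absolutely convergent power series on the closed disc\<close>

lemma disc_coeffs_eqI:
  assumes "is_disc_coeffs H h"
  shows "disc_coeffs H = h"
proof -
  have "h' = h" if h': "is_disc_coeffs H h'" for h'
  proof
    fix m
    define d where "d k = h' k - h k" for k
    have d: "(\<lambda>k. d k * z ^ k) sums 0" if "norm z \<le> 1" for z
      using sums_diff[of "\<lambda>k. h' k * z ^ k" "H z" "\<lambda>k. h k * z ^ k" "H z"] that assms h'
      by (simp add: is_disc_coeffs_def d_def algebra_simps)
    have "d m = 0"
    proof (rule ccontr)
      assume dm: "d m \<noteq> 0"
      have "d 0 = 0" using d[of 0] by simp
      then have "m > 0" using dm by (cases m) auto
      \<comment> \<open>Zeros of a nontrivial power series are isolated, so a nonzero coefficient
        \<open>d m\<close> would make the zero function nonzero on a punctured disc.\<close>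
      show False
      proof (rule powser_0_nonzero[of 1 0 d "\<lambda>_. 0" m])
        fix r :: real
        assume "0 < r" "\<And>z :: complex. z \<in> cball 0 r - {0} \<Longrightarrow> (0 :: complex) \<noteq> 0"
        from this(2)[of "of_real r"] \<open>0 < r\<close> show False by simp
      qed (use d dm \<open>m > 0\<close> in auto)
    qed
    then show "h' m = h m" by (simp add: d_def)
  qed
  then show ?thesis unfolding disc_coeffs_def using assms by blast
qed

lemma
  assumes "0 \<le> a" "a \<le> 1" "is_disc_coeffs H h"
    and "summable (\<lambda>n. norm (Weyl_sum (- a) h n) * cesaro_num (a + 1) n)"
  shows A_discI: "H \<in> A_disc a"
    and A_norm_eq: "A_norm a H = (\<Sum>n. norm (Weyl_sum (- a) h n) * cesaro_num (a + 1) n)"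
proof -
  have *: "is_Weyl_diff a h (Weyl_sum (- a) h)"
    using assms by (intro is_Weyl_diff_Weyl_sum_uminus) (auto simp: is_disc_coeffs_def)
  then show "H \<in> A_disc a" using assms(3) by (auto simp: A_disc_def)
  show "A_norm a H = (\<Sum>n. norm (Weyl_sum (- a) h n) * cesaro_num (a + 1) n)"
    by (simp add: A_norm_def disc_coeffs_eqI[OF assms(3)] Weyl_diff_eqI[OF assms(1,2) *])
qed

lemma is_disc_coeffs_diff:
  assumes "is_disc_coeffs H h" "is_disc_coeffs H' h'"
  shows "is_disc_coeffs (\<lambda>z. H z - H' z) (\<lambda>n. h n - h' n)"
  unfolding is_disc_coeffs_def
proof (intro conjI allI impI)
  show "summable (\<lambda>n. norm (h n - h' n))"
    by (rule summable_comparison_test'[of "\<lambda>n. norm (h n) + norm (h' n)"])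
      (use assms in \<open>auto simp: is_disc_coeffs_def intro: summable_add norm_triangle_ineq4\<close>)
  show "(\<lambda>n. (h n - h' n) * z ^ n) sums (H z - H' z)" if "norm z \<le> 1" for z
    using assms that by (auto simp: is_disc_coeffs_def left_diff_distrib intro: sums_diff)
qed

lemma is_disc_coeffs_mult:
  assumes "is_disc_coeffs H h" "is_disc_coeffs H' h'"
  shows "is_disc_coeffs (\<lambda>z. H z * H' z) (\<lambda>n. \<Sum>i\<le>n. h i * h' (n - i))"
  unfolding is_disc_coeffs_def
proof (intro conjI allI impI)
  have sm: "summable (\<lambda>n. norm (h n))" "summable (\<lambda>n. norm (h' n))"
    using assms by (auto simp: is_disc_coeffs_def)
  have "summable (\<lambda>n. \<Sum>i\<le>n. norm (h i) * norm (h' (n - i)))"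
    using sm by (intro summable_Cauchy_product) auto
  then show "summable (\<lambda>n. norm (\<Sum>i\<le>n. h i * h' (n - i)))"
    by (rule summable_comparison_test')
      (use norm_sum[of "\<lambda>i. h i * h' (_ - i)"] in \<open>auto simp: norm_mult\<close>)
  fix z :: complex assume z: "norm z \<le> 1"
  have *: "summable (\<lambda>n. norm (g n * z ^ n))" if "summable (\<lambda>n. norm (g n))" for g :: "nat \<Rightarrow> complex"
    by (rule summable_comparison_test'[OF that])
      (use z in \<open>auto simp: norm_mult norm_power intro!: mult_left_le power_le_one\<close>)
  have "(\<lambda>n. \<Sum>i\<le>n. (h i * z ^ i) * (h' (n - i) * z ^ (n - i))) sums
      ((\<Sum>n. h n * z ^ n) * (\<Sum>n. h' n * z ^ n))"
    using sm by (intro Cauchy_product_sums *)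
  moreover have "(\<Sum>n. h n * z ^ n) = H z" "(\<Sum>n. h' n * z ^ n) = H' z"
    using assms z by (auto simp: is_disc_coeffs_def sums_iff)
  moreover have "(\<Sum>i\<le>n. (h i * z ^ i) * (h' (n - i) * z ^ (n - i))) = (\<Sum>i\<le>n. h i * h' (n - i)) * z ^ n" for n
    by (subst sum_distrib_right, rule sum.cong) (auto simp: algebra_simps simp flip: power_add)
  ultimately show "(\<lambda>n. (\<Sum>i\<le>n. h i * h' (n - i)) * z ^ n) sums (H z * H' z)"
    by simp
qed

lemma is_disc_coeffs_polynomial:
  "is_disc_coeffs (\<lambda>z. \<Sum>j<n. c j * z ^ j) (\<lambda>j. if j < n then c j else 0)"
  unfolding is_disc_coeffs_def
proof (intro conjI allI impI)
  show "summable (\<lambda>j. norm (if j < n then c j else 0))"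
    by (rule summable_finite[of "{..<n}"]) auto
  fix z :: complex
  have "(\<lambda>j. (if j < n then c j else 0) * z ^ j) sums (\<Sum>j<n. (if j < n then c j else 0) * z ^ j)"
    by (rule sums_finite) auto
  then show "(\<lambda>j. (if j < n then c j else 0) * z ^ j) sums (\<Sum>j<n. c j * z ^ j)"
    by simp
qed

text \<open>The binomial series gives the identity in the open disc only. Both sides are continuous
  on the closed disc, so it extends to the boundary, including z = 1.\<close>

lemma is_disc_coeffs_one_minus_powr:
  assumes "0 < s" "s \<le> 1"
  shows "is_disc_coeffs (\<lambda>z. (1 - z) powr of_real s) (\<lambda>j. of_real (cesaro_num (- s) j))"
  unfolding is_disc_coeffs_def
proof (intro conjI allI impI)
  let ?f = "\<lambda>z::complex. (1 - z) powr of_real s"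
  let ?p = "\<lambda>z::complex. \<Sum>j. of_real (cesaro_num (- s) j) * z ^ j"
  have sm: "summable (\<lambda>j. \<bar>cesaro_num (- s) j\<bar>)"
    using assms by (intro summable_abs_cesaro_num_uminus) auto
  then show "summable (\<lambda>j. norm (complex_of_real (cesaro_num (- s) j)))" by simp
  fix z :: complex assume z: "norm z \<le> 1"
  have bd: "norm (of_real (cesaro_num (- s) j) * z ^ j) \<le> \<bar>cesaro_num (- s) j\<bar>" if "norm z \<le> 1" for j and z :: complex
    using that by (auto simp: norm_mult norm_power intro!: mult_left_le power_le_one)
  have sz: "summable (\<lambda>j. of_real (cesaro_num (- s) j) * z ^ j)"
    by (rule summable_comparison_test'[OF sm]) (use bd z in auto)
  have "uniform_limit (cball 0 1) (\<lambda>n z. \<Sum>j<n. of_real (cesaro_num (- s) j) * z ^ j) ?p sequentially"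
    by (rule Weierstrass_m_test[OF _ sm]) (use bd in auto)
  then have "continuous_on (cball 0 1) ?p"
    by (rule uniform_limit_theorem[rotated]) (auto intro!: always_eventually continuous_intros)
  \<comment> \<open>On the disc 1 - z has nonnegative real part and so avoids the branch cut; at its
    zero z = 1, continuity comes from the positive exponent.\<close>
  moreover have "continuous_on (cball 0 1) ?f"
  proof (rule continuous_on_powr_complex)
    show "cball 0 1 \<subseteq> {z. 0 \<le> Re (1 - z) \<or> Im (1 - z) \<noteq> 0}"
      by (auto dest: order_trans[OF complex_Re_le_cmod])
  qed (use assms in \<open>auto intro!: continuous_intros\<close>)
  ultimately have "continuous_on (closure (ball 0 1)) (\<lambda>z. ?p z - ?f z)"
    by (auto intro: continuous_on_diff)
  moreover have "?p w - ?f w = 0" if "w \<in> ball 0 1" for w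
  proof -
    have "(\<lambda>n. (of_real s gchoose n) * (- w) ^ n) sums (1 + (- w)) powr of_real s"
      using that by (intro gen_binomial_complex) auto
    moreover have "(of_real s gchoose n) * (- w) ^ n = of_real (cesaro_num (- s) n) * w ^ n" for n
      by (simp add: cesaro_num_def gbinomial_pochhammer power_minus[of w] pochhammer_of_real
          flip: of_real_minus)
    ultimately show ?thesis by (simp add: sums_iff)
  qed
  ultimately have "?p z - ?f z = 0"
    by (rule continuous_constant_on_closure) (use z in auto)
  then show "(\<lambda>j. of_real (cesaro_num (- s) j) * z ^ j) sums ?f z"
    using sz by (simp add: sums_iff)
qed

lemma is_disc_coeffs_shift:
  assumes "is_disc_coeffs H h"
  shows "is_disc_coeffs (\<lambda>z. z * H z) (\<lambda>n. case n of 0 \<Rightarrow> 0 | Suc m \<Rightarrow> h m)"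
  unfolding is_disc_coeffs_def
proof (intro conjI allI impI)
  show "summable (\<lambda>n. norm (case n of 0 \<Rightarrow> 0 | Suc m \<Rightarrow> h m))"
    using assms by (subst summable_Suc_iff[symmetric]) (simp add: is_disc_coeffs_def)
  fix z :: complex assume "norm z \<le> 1"
  then have "(\<lambda>n. z * (h n * z ^ n)) sums (z * H z)"
    using assms by (intro sums_mult) (simp add: is_disc_coeffs_def)
  then show "(\<lambda>n. (case n of 0 \<Rightarrow> 0 | Suc m \<Rightarrow> h m) * z ^ n) sums (z * H z)"
    using sums_Suc_iff[of "\<lambda>n. (case n of 0 \<Rightarrow> 0 | Suc m \<Rightarrow> h m) * z ^ n" "z * H z"]
    by (simp add: algebra_simps)
qed

section \<open>Fractional differences of real sequences\<close>

text \<open>The real counterpart of \<^term>\<open>Weyl_sum (- a)\<close>, that is, of the paper's \<open>D\<^sup>a\<close>.\<close>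

definition frac_diff :: "real \<Rightarrow> (nat \<Rightarrow> real) \<Rightarrow> nat \<Rightarrow> real" where
  "frac_diff a f m = (\<Sum>j. cesaro_num (- a) j * f (m + j))"

lemma summable_frac_diff:
  assumes "0 \<le> a" "a \<le> 1" "summable (\<lambda>n. \<bar>f n\<bar>)"
  shows "summable (\<lambda>j. cesaro_num (- a) j * f (m + j))"
proof (rule summable_comparison_test')
  show "summable (\<lambda>j. \<bar>f (m + j)\<bar>)"
    using assms(3) by (simp add: summable_iff_shift[of "\<lambda>n. \<bar>f n\<bar>" m] add.commute)
  show "norm (cesaro_num (- a) j * f (m + j)) \<le> \<bar>f (m + j)\<bar>" if "0 \<le> j" for j
    using abs_cesaro_num_le_one[of "- a" j] assms by (simp add: abs_mult mult_left_le_one_le)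
qed

lemma frac_diff_diff:
  assumes "0 \<le> a" "a \<le> 1" "summable (\<lambda>n. \<bar>f n\<bar>)" "summable (\<lambda>n. \<bar>g n\<bar>)"
  shows "frac_diff a (\<lambda>n. f n - g n) m = frac_diff a f m - frac_diff a g m"
  using suminf_diff[OF summable_frac_diff[OF assms(1-3)] summable_frac_diff[OF assms(1,2,4)], of m m]
  by (simp add: frac_diff_def right_diff_distrib)

lemma Weyl_sum_of_real:
  assumes "0 \<le> a" "a \<le> 1" "summable (\<lambda>n. \<bar>f n\<bar>)"
  shows "Weyl_sum (- a) (\<lambda>n. of_real (f n)) m = of_real (frac_diff a f m)"
  using suminf_of_real[OF summable_frac_diff[OF assms], of m, where 'a = complex]
  by (simp add: frac_diff_def Weyl_sum_def)

text \<open>Every term after the first is a nonpositive coefficient times a nonnegative value. Where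
  f vanishes, this makes the fractional difference nonpositive.\<close>

lemma frac_diff_le:
  assumes "0 \<le> a" "a \<le> 1" "summable (\<lambda>n. \<bar>f n\<bar>)" "\<And>j. m < j \<Longrightarrow> 0 \<le> f j"
  shows "frac_diff a f m \<le> f m"
proof -
  have "(\<lambda>j. if j = 0 then f m else 0) sums f m"
    using sums_single[of 0 "\<lambda>_. f m"] by simp
  moreover have "cesaro_num (- a) j * f (m + j) \<le> (if j = 0 then f m else 0)" for j
    using cesaro_num_uminus_nonpos[OF assms(1,2), of j] assms(4)[of "m + j"]
    by (auto simp: mult_nonpos_nonneg)
  ultimately show ?thesis
    unfolding frac_diff_def using summable_frac_diff[OF assms(1-3)] by (meson sums_le summable_sums)
qed

text \<open>Replacing all later values by c only lowers the sum, and the coefficients from index 1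
  to N add up to k^(1-a)(N) - 1, at least -1. With c = f(m) this yields nonnegativity.\<close>

lemma frac_diff_ge:
  assumes "0 \<le> a" "a \<le> 1" "summable (\<lambda>n. \<bar>f n\<bar>)" "0 \<le> c" "\<And>j. m < j \<Longrightarrow> f j \<le> c"
  shows "f m - c \<le> frac_diff a f m"
proof -
  have "f m - c \<le> (\<Sum>j\<le>N. cesaro_num (- a) j * f (m + j))" for N
  proof -
    have "f m - c \<le> f m - c + c * cesaro_num (1 - a) N"
      using assms cesaro_num_nonneg[of "1 - a" N] by simp
    also have "\<dots> = (\<Sum>j\<le>N. (if j = 0 then f m - c else 0) + c * cesaro_num (- a) j)"
      by (simp add: sum.distrib cesaro_num_sum flip: sum_distrib_left)
    also have "\<dots> \<le> (\<Sum>j\<le>N. cesaro_num (- a) j * f (m + j))"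
    proof (rule sum_mono)
      fix j
      show "(if j = 0 then f m - c else 0) + c * cesaro_num (- a) j \<le> cesaro_num (- a) j * f (m + j)"
        using mult_left_mono_neg[OF assms(5)[of "m + j"] cesaro_num_uminus_nonpos[OF assms(1,2), of j]]
        by (auto simp: mult.commute)
    qed
    finally show ?thesis .
  qed
  moreover have "(\<lambda>N. \<Sum>j\<le>N. cesaro_num (- a) j * f (m + j)) \<longlonglongrightarrow> frac_diff a f m"
    unfolding frac_diff_def by (rule summable_LIMSEQ') (rule summable_frac_diff[OF assms(1-3)])
  ultimately show ?thesis by (meson LIMSEQ_le_const)
qed

lemma frac_diff_sums:
  assumes "0 \<le> a" "a \<le> 1" "summable (\<lambda>n. \<bar>f n\<bar>)"
  shows "(\<lambda>j. if m \<le> j then cesaro_num (- a) (j - m) * f j else 0) sums frac_diff a f m"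
proof -
  have "(\<lambda>j. cesaro_num (- a) j * f (m + j)) sums frac_diff a f m"
    unfolding frac_diff_def by (rule summable_sums) (rule summable_frac_diff[OF assms])
  then show ?thesis
    by (subst sums_zero_iff_shift[of m, symmetric]) (auto simp: add.commute)
qed

text \<open>Interchanges the finite sum over m with the series over j, so that f is paired with
  explicit weights. The next three lemmas evaluate or bound these weights.\<close>

lemma weighted_frac_diff_sums:
  assumes "0 \<le> a" "a \<le> 1" "summable (\<lambda>n. \<bar>f n\<bar>)"
  shows "(\<lambda>j. f j * (\<Sum>m<N. if m \<le> j then cesaro_num (- a) (j - m) * cesaro_num (1 + a) m else 0))
    sums (\<Sum>m<N. frac_diff a f m * cesaro_num (1 + a) m)"
proof -
  have "(\<lambda>j. \<Sum>m<N. (if m \<le> j then cesaro_num (- a) (j - m) * f j else 0) * cesaro_num (1 + a) m)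
    sums (\<Sum>m<N. frac_diff a f m * cesaro_num (1 + a) m)"
    by (intro sums_sum sums_mult2 frac_diff_sums assms)
  then show ?thesis
    by (rule sums_cong[THEN iffD1, rotated])
      (auto simp: sum_distrib_left algebra_simps intro!: sum.cong)
qed

text \<open>For j < N the truncation removes nothing, and the full convolution is k^(1+a) * k^(-a) =
  k^1.\<close>

lemma conv_weight_eq_one:
  assumes "j < N"
  shows "(\<Sum>m<N. if m \<le> j then cesaro_num (- a) (j - m) * cesaro_num (1 + a) m else 0) = 1"
proof -
  have "(\<Sum>m<N. if m \<le> j then cesaro_num (- a) (j - m) * cesaro_num (1 + a) m else 0)
      = (\<Sum>m\<le>j. cesaro_num (1 + a) m * cesaro_num (- a) (j - m))"
    using assms by (intro sum.mono_neutral_cong_right) (auto simp: mult.commute)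
  then show ?thesis by (simp add: cesaro_num_conv cesaro_num_one)
qed

text \<open>The truncation removes the term m = j, whose coefficient k^(-a)(0) = 1 is the positive
  one.\<close>

lemma conv_weight_nonpos:
  assumes "0 \<le> a" "a \<le> 1" "N \<le> j"
  shows "(\<Sum>m<N. if m \<le> j then cesaro_num (- a) (j - m) * cesaro_num (1 + a) m else 0) \<le> 0"
  using assms cesaro_num_uminus_nonpos[OF assms(1,2)] cesaro_num_nonneg[of "1 + a"]
  by (intro sum_nonpos) (auto intro!: mult_nonpos_nonneg)

text \<open>For m < N one has k^(1+a)(m) = ((a + m) / a) k^a(m), at most (N / a) k^a(m), which
  reduces the weight to the closed form of \<open>cesaro_num_partial_conv\<close>. The case a = 0 is
  split off because of the division.\<close>

lemma conv_weight_ge: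
  assumes "0 \<le> a" "a \<le> 1" "1 \<le> N" "N \<le> j"
  shows "- (real N / real j * cesaro_num (1 + a) (N - 1) * cesaro_num (1 - a) (j - N))
    \<le> (\<Sum>m<N. if m \<le> j then cesaro_num (- a) (j - m) * cesaro_num (1 + a) m else 0)" (is "_ \<le> ?w")
proof (cases "a = 0")
  case True
  then have "?w = 0" using assms by (intro sum.neutral) (auto simp: cesaro_num_zero)
  then show ?thesis using assms True by (simp add: cesaro_num_nonneg)
next
  case False
  then have a: "0 < a" using assms by simp
  obtain p where N: "N = Suc p" using assms(3) by (cases N) auto
  have "- (real N / real j * cesaro_num (1 + a) (N - 1) * cesaro_num (1 - a) (j - N))
      = real N / a * (\<Sum>m<N. cesaro_num a m * cesaro_num (- a) (j - m))"
    unfolding N using cesaro_num_partial_conv[of p j a] a assms(4) N by simp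
  also have "\<dots> = (\<Sum>m<N. cesaro_num (- a) (j - m) * (real N / a * cesaro_num a m))"
    by (simp add: sum_distrib_left algebra_simps)
  also have "\<dots> \<le> ?w"
  proof (rule sum_mono)
    fix m assume m: "m \<in> {..<N}"
    have "(a + real m) * cesaro_num a m \<le> real N * cesaro_num a m"
      using m assms cesaro_num_nonneg[of a m] by (intro mult_right_mono) auto
    then have "cesaro_num (1 + a) m \<le> real N / a * cesaro_num a m"
      using a cesaro_num_shift[of a m] by (simp add: field_simps)
    then have "cesaro_num (- a) (j - m) * (real N / a * cesaro_num a m)
        \<le> cesaro_num (- a) (j - m) * cesaro_num (1 + a) m"
      using m assms cesaro_num_uminus_nonpos[OF assms(1,2), of "j - m"]
      by (intro mult_left_mono_neg) auto
    then show "cesaro_num (- a) (j - m) * (real N / a * cesaro_num a m)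
        \<le> (if m \<le> j then cesaro_num (- a) (j - m) * cesaro_num (1 + a) m else 0)"
      using m assms by simp
  qed
  finally show ?thesis .
qed

section \<open>The coefficients of \<open>1 - g\<^sub>n\<close>\<close>

definition tail_coeff :: "real \<Rightarrow> nat \<Rightarrow> nat \<Rightarrow> real" where
  "tail_coeff s n m =
    (if m < n then 0 else s / real m * cesaro_num (1 + s) (n - 1) * cesaro_num (1 - s) (m - n))"

lemma tail_coeff_nonneg: "0 < s \<Longrightarrow> s < 1 \<Longrightarrow> 0 \<le> tail_coeff s n m"
  by (simp add: tail_coeff_def cesaro_num_nonneg)

lemma tail_coeff_self: "1 \<le> n \<Longrightarrow> tail_coeff s n n = cesaro_num s n"
  by (cases n) (simp_all add: tail_coeff_def cesaro_num_Suc_shift add.commute)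

text \<open>Discrete Leibniz rule: in a'(b - b') + (a - a')b every factor decreases along the
  sequence.\<close>

lemma convex_decreasing_mult:
  fixes a0 a1 a2 b0 b1 b2 :: real
  assumes "0 \<le> a2" "a2 \<le> a1" "a1 \<le> a0" "a1 - a2 \<le> a0 - a1"
    and "0 \<le> b2" "b2 \<le> b1" "b1 \<le> b0" "b1 - b2 \<le> b0 - b1"
  shows "a1 * b1 - a2 * b2 \<le> a0 * b0 - a1 * b1"
proof -
  have "a1 * b1 - a2 * b2 = (a1 - a2) * b1 + a2 * (b1 - b2)" by (simp add: algebra_simps)
  also have "\<dots> \<le> (a0 - a1) * b0 + a1 * (b0 - b1)"
    using assms by (intro add_mono mult_mono) auto
  also have "\<dots> = a0 * b0 - a1 * b1" by (simp add: algebra_simps)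
  finally show ?thesis .
qed

text \<open>From n on, the sequence is a nonnegative constant times 1/m times k^(1-s)(m-n). Both
  variable factors are nonnegative, decreasing and convex, properties inherited by products.\<close>

lemma
  assumes s: "0 < s" "s < 1" and n: "1 \<le> n" "n \<le> m"
  shows tail_coeff_decreasing: "tail_coeff s n (Suc m) \<le> tail_coeff s n m"
    and tail_coeff_convex: "tail_coeff s n (Suc m) - tail_coeff s n (Suc (Suc m))
      \<le> tail_coeff s n m - tail_coeff s n (Suc m)"
proof -
  define A where "A i = s * cesaro_num (1 + s) (n - 1) / real i" for i
  define B where "B i = cesaro_num (1 - s) (i - n)" for i
  have c: "0 \<le> s * cesaro_num (1 + s) (n - 1)" using s by (simp add: cesaro_num_nonneg)
  have t: "tail_coeff s n i = A i * B i" if "n \<le> i" for i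
    using that by (simp add: tail_coeff_def A_def B_def)
  have A0: "0 \<le> A i" for i using c by (simp add: A_def)
  have A1: "A (Suc i) \<le> A i" if "0 < i" for i
    unfolding A_def using c that by (intro divide_left_mono) auto
  have A2: "A (Suc m) - A (Suc (Suc m)) \<le> A m - A (Suc m)"
  proof -
    have "1 / real (Suc m) - 1 / real (Suc (Suc m)) \<le> 1 / real m - 1 / real (Suc m)"
      using n by (simp add: field_simps) (rule frac_le, auto intro: add_pos_nonneg)
    from mult_left_mono[OF this c] show ?thesis by (simp add: A_def algebra_simps)
  qed
  have B0: "0 \<le> B i" for i using s by (simp add: B_def cesaro_num_nonneg)
  have B1: "B (Suc i) \<le> B i" if "n \<le> i" for i
    using that s cesaro_num_decseq[of "1 - s" "i - n"] by (simp add: B_def Suc_diff_le)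
  have B2: "B (Suc m) - B (Suc (Suc m)) \<le> B m - B (Suc m)"
    using n s cesaro_num_convex[of "1 - s" "m - n"] by (simp add: B_def Suc_diff_le)
  show "tail_coeff s n (Suc m) \<le> tail_coeff s n m"
    using n A0 A1 B0 B1 by (simp add: t mult_mono)
  show "tail_coeff s n (Suc m) - tail_coeff s n (Suc (Suc m)) \<le> tail_coeff s n m - tail_coeff s n (Suc m)"
    unfolding t[OF n(2)] t[OF le_SucI[OF n(2)]] t[OF le_SucI[OF le_SucI[OF n(2)]]]
    using n A0 A1 A2 B0 B1 B2 by (intro convex_decreasing_mult) auto
qed

text \<open>The coefficients of g_n convolve k^s, cut off at n, with k^(-s). Below n the cut is
  invisible and the convolution is k^0, which cancels the constant 1; from n on the truncated closed
  form applies.\<close>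

lemma is_disc_coeffs_tail:
  assumes "0 < s" "s < 1" "1 \<le> n"
  shows "is_disc_coeffs (\<lambda>z. 1 - g0 s n z) (\<lambda>m. of_real (tail_coeff s n m))"
proof -
  let ?c = "\<lambda>i. if i < n then complex_of_real (cesaro_num s i) else 0"
  have "is_disc_coeffs (\<lambda>z. (\<Sum>j<1. 1 * z ^ j) - (\<Sum>j<n. of_real (cesaro_num s j) * z ^ j) * (1 - z) powr of_real s)
      (\<lambda>m. (if m < 1 then 1 else 0) - (\<Sum>i\<le>m. ?c i * of_real (cesaro_num (- s) (m - i))))"
    using assms by (intro is_disc_coeffs_diff is_disc_coeffs_mult is_disc_coeffs_polynomial
        is_disc_coeffs_one_minus_powr) auto
  moreover have "(if m < 1 then 1 else 0) - (\<Sum>i\<le>m. ?c i * of_real (cesaro_num (- s) (m - i)))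
      = of_real (tail_coeff s n m)" for m
  proof (cases "m < n")
    case True
    then have "(\<Sum>i\<le>m. ?c i * of_real (cesaro_num (- s) (m - i)))
        = of_real (\<Sum>i\<le>m. cesaro_num s i * cesaro_num (- s) (m - i))"
      by simp
    then show ?thesis using True by (simp add: cesaro_num_conv cesaro_num_zero tail_coeff_def)
  next
    case False
    then have "(\<Sum>i\<le>m. ?c i * of_real (cesaro_num (- s) (m - i)))
        = (\<Sum>i<n. of_real (cesaro_num s i * cesaro_num (- s) (m - i)))"
      by (intro sum.mono_neutral_cong_right) auto
    also have "\<dots> = - of_real (tail_coeff s n m)"
      using cesaro_num_partial_conv[of "n - 1" m s] False assms(3)
      by (simp add: tail_coeff_def flip: of_real_sum of_real_mult)
    finally show ?thesis using False assms(3) by simp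
  qed
  ultimately show ?thesis by (simp add: g0_def mult.commute)
qed

text \<open>Evaluation at z = 1, where g_n vanishes because \<open>0 powr s\<close> is 0.\<close>

lemma tail_coeff_sums_one:
  assumes "0 < s" "s < 1" "1 \<le> n"
  shows "tail_coeff s n sums 1"
proof -
  have "(\<lambda>m. of_real (tail_coeff s n m) * 1 ^ m) sums (1 - g0 s n 1)"
    using is_disc_coeffs_tail[OF assms] unfolding is_disc_coeffs_def by (metis norm_one order_refl)
  then have "(\<lambda>m. complex_of_real (tail_coeff s n m)) sums of_real 1"
    by (simp add: g0_def)
  then show ?thesis by (simp only: sums_of_real_iff)
qed

lemma summable_tail_coeff:
  assumes "0 < s" "s < 1" "1 \<le> n"
  shows "summable (\<lambda>m. \<bar>tail_coeff s n m\<bar>)"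
  using sums_summable[OF tail_coeff_sums_one[OF assms]] tail_coeff_nonneg[OF assms(1,2)] by simp

lemma decreasing_from:
  fixes f :: "nat \<Rightarrow> real"
  assumes "\<And>m. n \<le> m \<Longrightarrow> f (Suc m) \<le> f m" "n \<le> i" "i \<le> j"
  shows "f j \<le> f i"
  using assms(3,2) by (induction rule: dec_induct) (auto intro: order_trans[OF assms(1)])

lemma sum_lessThan_add:
  fixes f :: "nat \<Rightarrow> real"
  shows "(\<Sum>m<n + p. f m) = (\<Sum>m<n. f m) + (\<Sum>i<p. f (n + i))"
  by (induction p) simp_all

section \<open>Norm estimates\<close>

lemma weighted_norm_tail_bounded:
  assumes s: "0 < s" and a: "0 \<le> a" "a < 1 - s"
  shows "\<exists>M>0. \<forall>n\<ge>1. \<forall>N.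
    (\<Sum>m<N. \<bar>frac_diff a (tail_coeff s n) m\<bar> * cesaro_num (1 + a) m) \<le> M"
proof -
  define c where "c = s + a"
  have c: "0 < c" "c < 1" "s \<le> c" and s1: "s < 1" and a1: "a \<le> 1" using s a by (auto simp: c_def)
  obtain C1 where C1: "C1 > 0" "\<And>n. cesaro_num (1 + s) n * cesaro_num (1 + a) n \<le> C1 * cesaro_num (1 + c) n"
    using cesaro_num_mult_le[of "1 + s" "1 + a"] s a by (auto simp: c_def add_ac)
  \<comment> \<open>This comparison needs 1 < (1 - s) + (1 - a), which is exactly s + a < 1.\<close>
  obtain C2 where C2: "C2 > 0" "\<And>n. cesaro_num (1 - s) n * cesaro_num (1 - a) n \<le> C2 * cesaro_num (1 - c) n"
    using cesaro_num_mult_le[of "1 - s" "1 - a"] s a by (auto simp: c_def algebra_simps)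
  have "(\<Sum>m<N. \<bar>frac_diff a (tail_coeff s n) m\<bar> * cesaro_num (1 + a) m) \<le> 1 + 2 * (C1 * C2)"
    if n: "1 \<le> n" for n N
  proof -
    let ?r = "tail_coeff s n" and ?U = "frac_diff a (tail_coeff s n)" and ?k = "cesaro_num (1 + a)"
    define w where "w N j = (\<Sum>m<N. if m \<le> j then cesaro_num (- a) (j - m) * ?k m else 0)" for N j
    note r0 = tail_coeff_nonneg[OF s s1] and sr = summable_tail_coeff[OF s s1 n]
    have sums: "(\<lambda>j. ?r j * w N j) sums (\<Sum>m<N. ?U m * ?k m)" for N
      unfolding w_def by (rule weighted_frac_diff_sums[OF a(1) a1 sr])
    \<comment> \<open>The weights never exceed 1, so pairing them with r gives at most the total
      mass of r.\<close>
    have upper: "(\<Sum>m<N. ?U m * ?k m) \<le> 1" for N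
    proof (rule sums_le[OF _ sums tail_coeff_sums_one[OF s s1 n]])
      fix j
      have "w N j \<le> 1"
        using conv_weight_eq_one[of j N a] conv_weight_nonpos[OF a(1) a1, of N j]
        by (cases "j < N") (auto simp: w_def)
      then show "?r j * w N j \<le> ?r j" using r0[of n j] by (simp add: mult_left_le)
    qed
    have "- (\<Sum>m<n. ?U m * ?k m) \<le> C1 * C2 * 1"
    proof (rule sums_le[OF _ sums_minus[OF sums] sums_mult[OF tail_coeff_sums_one[OF c(1,2) n]]])
      fix j
      show "- (?r j * w n j) \<le> C1 * C2 * tail_coeff c n j"
      proof (cases "j < n")
        case False
        then have j: "n \<le> j" "0 < j" using n by auto
        define X where "X = cesaro_num (1 + s) (n - 1) * ?k (n - 1)"
        define Y where "Y = cesaro_num (1 - s) (j - n) * cesaro_num (1 - a) (j - n)"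
        have XY: "0 \<le> X" "0 \<le> Y" "X \<le> C1 * cesaro_num (1 + c) (n - 1)" "Y \<le> C2 * cesaro_num (1 - c) (j - n)"
          using C1(2) C2(2) s s1 a a1 by (auto simp: X_def Y_def cesaro_num_nonneg)
        have "- (?r j * w n j) = ?r j * (- w n j)" by simp
        also have "\<dots> \<le> ?r j * (real n / real j * ?k (n - 1) * cesaro_num (1 - a) (j - n))"
          using conv_weight_ge[OF a(1) a1 n j(1)] r0 by (intro mult_left_mono) (auto simp: w_def)
        also have "\<dots> = (s / real j * (real n / real j)) * (X * Y)"
          using False by (simp add: tail_coeff_def X_def Y_def)
        \<comment> \<open>Uses s <= c, n <= j and the two product comparisons; the result is a
          multiple of the tail coefficient with parameter c, whose total mass is again 1.\<close>
        also have "\<dots> \<le> (c / real j * 1) * ((C1 * cesaro_num (1 + c) (n - 1)) * (C2 * cesaro_num (1 - c) (j - n)))"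
          using XY j c s by (intro mult_mono divide_right_mono) (auto simp: divide_simps)
        also have "\<dots> = C1 * C2 * tail_coeff c n j"
          using False by (simp add: tail_coeff_def)
        finally show ?thesis .
      qed (simp add: tail_coeff_def)
    qed
    then have lower: "- (\<Sum>m<n. ?U m * ?k m) \<le> C1 * C2" by simp
    have k0: "0 \<le> ?k m" for m using a by (simp add: cesaro_num_nonneg)
    have U_neg: "?U m \<le> 0" if "m < n" for m
      using frac_diff_le[OF a(1) a1 sr, of m] r0 that by (simp add: tail_coeff_def[of s n m])
    have U_pos: "0 \<le> ?U m" if "n \<le> m" for m
      using frac_diff_ge[OF a(1) a1 sr r0[of n m], of m] that
        decreasing_from[of n ?r m, OF tail_coeff_decreasing[OF s s1 n]]
      by simp
    \<comment> \<open>Padding to n + N includes every index below n. There U is nonpositive, so the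
      absolute sum is the signed sum minus twice its part below n; hence the bound 1 + 2 C1
      C2.\<close>
    have "(\<Sum>m<N. \<bar>?U m\<bar> * ?k m) \<le> (\<Sum>m<n + N. \<bar>?U m\<bar> * ?k m)"
      using k0 by (intro sum_mono2) auto
    also have "\<dots> = (\<Sum>m<n + N. ?U m * ?k m - 2 * (if m < n then ?U m * ?k m else 0))"
      using U_neg U_pos by (intro sum.cong) auto
    also have "\<dots> = (\<Sum>m<n + N. ?U m * ?k m) - 2 * (\<Sum>m<n + N. if m < n then ?U m * ?k m else 0)"
      by (simp add: sum_subtractf sum_distrib_left)
    also have "(\<Sum>m<n + N. if m < n then ?U m * ?k m else 0) = (\<Sum>m<n. ?U m * ?k m)"
      by (intro sum.mono_neutral_cong_right) auto
    finally show ?thesis using upper[of "n + N"] lower by simp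
  qed
  moreover have "0 < 1 + 2 * (C1 * C2)" using C1(1) C2(1) by (simp add: add_pos_pos)
  ultimately show ?thesis by blast
qed

lemma frac_diff_shift:
  "frac_diff a (\<lambda>n. case n of 0 \<Rightarrow> c | Suc m \<Rightarrow> f m) (Suc m) = frac_diff a f m"
  by (simp add: frac_diff_def)

text \<open>With U' the fractional difference of the shifted sequence, V = U - U' has constant sign
  below n, at n and above n. These ranges contribute 1, 2 and 1 times k^(1+a)(n) r(n), the last with
  the extra T / n.\<close>

lemma weighted_norm_diff_le:
  fixes r :: "nat \<Rightarrow> real"
  assumes a: "0 \<le> a" "a \<le> 1" and n: "1 \<le> n" and sr: "summable (\<lambda>m. \<bar>r m\<bar>)"
    and r0: "\<And>m. 0 \<le> r m" and rz: "\<And>m. m < n \<Longrightarrow> r m = 0"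
    and dec: "\<And>m. n \<le> m \<Longrightarrow> r (Suc m) \<le> r m"
    and conv: "\<And>m. n \<le> m \<Longrightarrow> r (Suc m) - r (Suc (Suc m)) \<le> r m - r (Suc m)"
    and T: "\<And>N. (\<Sum>m<N. \<bar>frac_diff a r m\<bar> * cesaro_num (1 + a) m) \<le> T"
  shows "(\<Sum>m<N. \<bar>frac_diff a (\<lambda>m. r m - (case m of 0 \<Rightarrow> 0 | Suc l \<Rightarrow> r l)) m\<bar> * cesaro_num (1 + a) m)
    \<le> 4 * (cesaro_num (1 + a) n * r n) + T / real n" (is "(\<Sum>m<N. \<bar>?V m\<bar> * ?k m) \<le> _")
proof -
  define r' where "r' m = (case m of 0 \<Rightarrow> 0 | Suc l \<Rightarrow> r l)" for m
  define U where "U = frac_diff a r"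
  define U' where "U' = frac_diff a r'"
  have sr': "summable (\<lambda>m. \<bar>r' m\<bar>)"
    using sr by (subst summable_Suc_iff[symmetric]) (simp add: r'_def)
  have r'0: "0 \<le> r' m" for m using r0 by (simp add: r'_def split: nat.split)
  have V: "?V m = U m - U' m" for m
    unfolding U_def U'_def r'_def[symmetric] by (rule frac_diff_diff[OF a sr sr'])
  have U'_Suc: "U' (Suc m) = U m" for m
    unfolding U_def U'_def r'_def[abs_def] by (rule frac_diff_shift)
  have k0: "0 \<le> ?k m" for m using a by (simp add: cesaro_num_nonneg)
  have rn: "r m \<le> r n" for m
    using decreasing_from[of n r n m, OF dec] rz[of m] r0[of n] by (cases "m < n") auto
  have U_n: "0 \<le> U n" "U n \<le> r n"
    using frac_diff_ge[OF a sr r0[of n], of n] frac_diff_le[OF a sr, of n] rn r0 by (auto simp: U_def)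
  have r'n: "r' m = 0" if "m \<le> n" for m
    using that rz by (auto simp: r'_def split: nat.split)
  have U'_nonpos: "U' m \<le> 0" if "m \<le> n" for m
    using frac_diff_le[OF a sr', of m] r'0 r'n[OF that] by (auto simp: U'_def)
  have "r' j \<le> r n" for j using rn r0[of n] by (simp add: r'_def split: nat.split)
  then have U'_n: "- r n \<le> U' n"
    using frac_diff_ge[OF a sr' r0[of n], of n] r'n[of n] by (auto simp: U'_def)
  \<comment> \<open>After its vanishing first term is dropped, U' pairs r with k^(-a)(j+1) where U
    uses k^(-a)(j). Monotonicity of the coefficients fails only at j = 0, where r(m) = 0.\<close>
  have left: "U m \<le> U' m" if "m < n" for m
  proof -
    have "(\<lambda>j. cesaro_num (- a) (Suc j) * r' (m + Suc j)) sums (U' m - cesaro_num (- a) 0 * r' (m + 0))"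
      unfolding U'_def frac_diff_def
      by (subst sums_Suc_iff) (use summable_sums[OF summable_frac_diff[OF a sr']] in simp)
    then have "(\<lambda>j. cesaro_num (- a) (Suc j) * r (m + j)) sums U' m"
      using r'n[of m] that by (simp add: r'_def[of "Suc _"])
    moreover have "(\<lambda>j. cesaro_num (- a) j * r (m + j)) sums U m"
      unfolding U_def frac_diff_def by (rule summable_sums[OF summable_frac_diff[OF a sr]])
    moreover have "cesaro_num (- a) j * r (m + j) \<le> cesaro_num (- a) (Suc j) * r (m + j)" for j
      using rz[OF that] r0 cesaro_num_uminus_mono[OF a, of j]
      by (cases "j = 0") (auto intro: mult_right_mono)
    ultimately show ?thesis by (meson sums_le)
  qed
  \<comment> \<open>Convexity makes r(m) - r(m+1) decreasing from n on, so its fractional difference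
    U(m) - U(m+1) is nonnegative by \<open>frac_diff_ge\<close>.\<close>
  have right: "U (Suc m) \<le> U m" if m: "n \<le> m" for m
  proof -
    have sS: "summable (\<lambda>m. \<bar>r (Suc m)\<bar>)" using sr summable_Suc_iff[of "\<lambda>m. \<bar>r m\<bar>"] by simp
    have sd: "summable (\<lambda>m. \<bar>r m - r (Suc m)\<bar>)"
      by (rule summable_comparison_test'[OF summable_add[OF sr sS]]) (auto intro: abs_triangle_ineq4)
    have "0 \<le> r m - r (Suc m)" using dec[OF m] by simp
    moreover have "r j - r (Suc j) \<le> r m - r (Suc m)" if "m < j" for j
      using decreasing_from[of n "\<lambda>m. r m - r (Suc m)" m j, OF conv] that m by simp
    ultimately have "0 \<le> frac_diff a (\<lambda>m. r m - r (Suc m)) m"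
      using frac_diff_ge[OF a sd, of "r m - r (Suc m)" m] by simp
    also have "\<dots> = U m - U (Suc m)"
      unfolding frac_diff_diff[OF a sr sS] by (simp add: U_def frac_diff_def)
    finally show ?thesis by simp
  qed
  have U_nonneg: "0 \<le> U m" if "n \<le> m" for m
    using frac_diff_ge[OF a sr r0[of m], of m] that decreasing_from[of n r m, OF dec] by (simp add: U_def)
  have part1: "(\<Sum>m<n. \<bar>?V m\<bar> * ?k m) \<le> ?k n * r n"
  proof -
    have "(\<Sum>m<n. \<bar>?V m\<bar> * ?k m) \<le> (\<Sum>m<n. (U' m - U' (Suc m)) * ?k n)"
    proof (rule sum_mono)
      fix m assume "m \<in> {..<n}"
      then show "\<bar>?V m\<bar> * ?k m \<le> (U' m - U' (Suc m)) * ?k n"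
        unfolding V U'_Suc using left[of m] k0 incseqD[OF cesaro_num_incseq[OF a(1)], of m n]
        by (intro mult_mono) auto
    qed
    also have "\<dots> = ?k n * (U' 0 - U' n)"
      unfolding sum_distrib_right[symmetric] sum_lessThan_telescope' by (rule mult.commute)
    also have "\<dots> \<le> ?k n * r n"
      using U'_nonpos[of 0] U'_n k0 by (intro mult_left_mono) auto
    finally show ?thesis .
  qed
  have part2: "\<bar>?V n\<bar> * ?k n \<le> 2 * (?k n * r n)"
  proof -
    have "\<bar>?V n\<bar> \<le> 2 * r n" unfolding V using U_n U'_n U'_nonpos[of n] by simp
    from mult_right_mono[OF this k0[of n]] show ?thesis by (simp add: mult_ac)
  qed
  have part3: "(\<Sum>i<p. \<bar>?V (Suc n + i)\<bar> * ?k (Suc n + i)) \<le> ?k n * r n + T / real n" for p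
  proof -
    have "(\<Sum>i<p. \<bar>?V (Suc n + i)\<bar> * ?k (Suc n + i))
        = (\<Sum>i<p. (U (n + i) - U (Suc n + i)) * ?k (Suc n + i))"
      unfolding V using right by (intro sum.cong) (simp_all add: U'_Suc)
    \<comment> \<open>Summation by parts; the increments of the weight k^(1+a) are values of k^a,
      and k^a(m+1) = a k^(1+a)(m) / (m+1) supplies the factor 1 / n.\<close>
    also have "\<dots> = U n * ?k n - U (n + p) * ?k (n + p)
        + (\<Sum>i<p. U (n + i) * cesaro_num a (Suc (n + i)))"
      by (induction p) (simp_all add: cesaro_num_add_Suc algebra_simps)
    also have "\<dots> \<le> ?k n * r n + (\<Sum>i<p. \<bar>U (n + i)\<bar> * ?k (n + i)) / real n"
    proof -
      have "U n * ?k n \<le> ?k n * r n" using U_n k0 by (simp add: mult.commute mult_right_mono)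
      moreover have "0 \<le> U (n + p) * ?k (n + p)" using U_nonneg k0 by simp
      moreover have "(\<Sum>i<p. U (n + i) * cesaro_num a (Suc (n + i)))
          \<le> (\<Sum>i<p. \<bar>U (n + i)\<bar> * ?k (n + i) / real n)"
      proof (rule sum_mono)
        fix i
        have "cesaro_num a (Suc (n + i)) \<le> 1 * ?k (n + i) / real n"
          unfolding cesaro_num_Suc_shift using a n k0[of "n + i"]
          by (intro frac_le mult_right_mono) auto
        then have "\<bar>U (n + i)\<bar> * cesaro_num a (Suc (n + i)) \<le> \<bar>U (n + i)\<bar> * (?k (n + i) / real n)"
          by (intro mult_left_mono) auto
        then show "U (n + i) * cesaro_num a (Suc (n + i)) \<le> \<bar>U (n + i)\<bar> * ?k (n + i) / real n"
          using U_nonneg[of "n + i"] by simp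
      qed
      ultimately show ?thesis by (simp add: sum_divide_distrib)
    qed
    also have "(\<Sum>i<p. \<bar>U (n + i)\<bar> * ?k (n + i)) \<le> (\<Sum>m<n + p. \<bar>U m\<bar> * ?k m)"
      using k0 by (simp add: sum_lessThan_add sum_nonneg)
    also have "\<dots> \<le> T" unfolding U_def by (rule T)
    finally show ?thesis by (simp add: divide_right_mono)
  qed
  have "(\<Sum>m<N. \<bar>?V m\<bar> * ?k m) \<le> (\<Sum>m<Suc n + N. \<bar>?V m\<bar> * ?k m)"
    using k0 by (intro sum_mono2) auto
  also have "\<dots> = (\<Sum>m<n. \<bar>?V m\<bar> * ?k m) + \<bar>?V n\<bar> * ?k n + (\<Sum>i<N. \<bar>?V (Suc n + i)\<bar> * ?k (Suc n + i))"
    by (simp only: sum_lessThan_add sum.lessThan_Suc)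
  finally show ?thesis using part1 part2 part3[of N] by simp
qed

section \<open>From bounds on real coefficients to the algebra norm\<close>

lemma
  assumes "0 \<le> a" "a \<le> 1" "is_disc_coeffs H (\<lambda>n. of_real (f n))"
    and B: "\<And>N. (\<Sum>m<N. \<bar>frac_diff a f m\<bar> * cesaro_num (1 + a) m) \<le> B"
  shows A_disc_realI: "H \<in> A_disc a"
    and A_norm_real_le: "A_norm a H \<le> B"
    and A_norm_real_nonneg: "0 \<le> A_norm a H"
proof -
  let ?w = "\<lambda>m. \<bar>frac_diff a f m\<bar> * cesaro_num (1 + a) m"
  have k0: "0 \<le> cesaro_num (1 + a) m" for m using assms(1) by (simp add: cesaro_num_nonneg)
  have sf: "summable (\<lambda>n. \<bar>f n\<bar>)" using assms(3) by (simp add: is_disc_coeffs_def)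
  have eq: "(\<lambda>m. norm (Weyl_sum (- a) (\<lambda>n. of_real (f n)) m) * cesaro_num (a + 1) m) = ?w"
    by (simp add: Weyl_sum_of_real[OF assms(1,2) sf] add.commute)
  have sm: "summable ?w" by (rule summableI_nonneg_bounded[of _ B]) (use k0 B in auto)
  show "H \<in> A_disc a" using A_discI[OF assms(1-3)] eq sm by simp
  have norm: "A_norm a H = suminf ?w" using A_norm_eq[OF assms(1-3)] eq sm by simp
  show "A_norm a H \<le> B" unfolding norm by (rule suminf_le_const[OF sm B])
  show "0 \<le> A_norm a H" unfolding norm using k0 by (intro suminf_nonneg[OF sm]) simp
qed

text \<open>Serves the polynomials 1 and 1 - z: the fractional difference vanishes wherever f and
  all its later values do, so a finite sum bounds all partial sums.\<close>

lemma weighted_norm_finite_support: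
  assumes "\<And>m. p \<le> m \<Longrightarrow> f m = 0" "0 \<le> a"
  shows "(\<Sum>m<N. \<bar>frac_diff a f m\<bar> * cesaro_num (1 + a) m)
    \<le> (\<Sum>m<p. \<bar>frac_diff a f m\<bar> * cesaro_num (1 + a) m)"
proof -
  have z: "frac_diff a f m = 0" if "p \<le> m" for m
    using that assms(1) by (simp add: frac_diff_def)
  have "(\<Sum>m<N. \<bar>frac_diff a f m\<bar> * cesaro_num (1 + a) m)
      \<le> (\<Sum>m<N + p. \<bar>frac_diff a f m\<bar> * cesaro_num (1 + a) m)"
    using assms(2) by (intro sum_mono2) (auto simp: cesaro_num_nonneg)
  also have "\<dots> = (\<Sum>m<p. \<bar>frac_diff a f m\<bar> * cesaro_num (1 + a) m)"
    using z by (intro sum.mono_neutral_right) auto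
  finally show ?thesis .
qed

lemma weighted_norm_triangle:
  assumes "0 \<le> a" "a \<le> 1" "summable (\<lambda>n. \<bar>f n\<bar>)" "summable (\<lambda>n. \<bar>g n\<bar>)"
    and "(\<Sum>m<N. \<bar>frac_diff a f m\<bar> * cesaro_num (1 + a) m) \<le> B"
    and "(\<Sum>m<N. \<bar>frac_diff a g m\<bar> * cesaro_num (1 + a) m) \<le> C"
  shows "(\<Sum>m<N. \<bar>frac_diff a (\<lambda>n. f n - g n) m\<bar> * cesaro_num (1 + a) m) \<le> B + C"
proof -
  have "(\<Sum>m<N. \<bar>frac_diff a (\<lambda>n. f n - g n) m\<bar> * cesaro_num (1 + a) m)
      \<le> (\<Sum>m<N. \<bar>frac_diff a f m\<bar> * cesaro_num (1 + a) m + \<bar>frac_diff a g m\<bar> * cesaro_num (1 + a) m)"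
    unfolding frac_diff_diff[OF assms(1-4)] distrib_right[symmetric] using assms(1)
    by (intro sum_mono mult_right_mono abs_triangle_ineq4) (simp add: cesaro_num_nonneg)
  then show ?thesis using assms(5,6) by (simp add: sum.distrib)
qed

lemma frac_diff_uminus:
  assumes "0 \<le> a" "a \<le> 1" "summable (\<lambda>n. \<bar>f n\<bar>)"
  shows "frac_diff a (\<lambda>n. - f n) m = - frac_diff a f m"
  using suminf_minus[OF summable_frac_diff[OF assms, of m]] by (simp add: frac_diff_def)

lemma is_disc_coeffs_one_minus_mult:
  assumes "is_disc_coeffs H (\<lambda>n. of_real (f n))"
  shows "is_disc_coeffs (\<lambda>z. (1 - z) * H z)
    (\<lambda>m. of_real (f m - (case m of 0 \<Rightarrow> 0 | Suc l \<Rightarrow> f l)))"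
proof -
  have "(case m of 0 \<Rightarrow> 0 | Suc l \<Rightarrow> complex_of_real (f l))
      = of_real (case m of 0 \<Rightarrow> 0 | Suc l \<Rightarrow> f l)" for m
    by (simp split: nat.split)
  then show ?thesis
    using is_disc_coeffs_diff[OF assms is_disc_coeffs_shift[OF assms]]
    by (simp add: left_diff_distrib)
qed

theorem theorem1:
  fixes s \<alpha> :: real
  assumes "0 < s" and "s < 1" and "0 \<le> \<alpha>" and "\<alpha> < 1 - s"
  shows "(\<exists>M>0. \<forall>n\<ge>1. g0 s n \<in> A_disc \<alpha> \<and> A_norm \<alpha> (g0 s n) \<le> M) \<and>
    (\<lambda>z. 1 - z) \<in> A_disc \<alpha> \<and>
    (\<forall>n\<ge>1. (\<lambda>z. (1 - z) * g0 s n z) \<in> A_disc \<alpha>) \<and>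
    (\<lambda>n. A_norm \<alpha> (\<lambda>z. (1 - z) * g0 s n z - (1 - z))) \<longlonglongrightarrow> 0"
proof -
  have a: "0 \<le> \<alpha>" "\<alpha> \<le> 1" using assms by auto
  let ?k = "cesaro_num (1 + \<alpha>)" and ?D = "frac_diff \<alpha>"
  \<comment> \<open>\<open>r n\<close>, \<open>q n\<close>, \<open>e\<close> and \<open>e'\<close>
    are the coefficients of 1 - g_n, (1 - z)(1 - g_n), 1 and 1 - z.\<close>
  define r where "r = tail_coeff s"
  define q where "q n m = r n m - (case m of 0 \<Rightarrow> 0 | Suc l \<Rightarrow> r n l)" for n m
  define e :: "nat \<Rightarrow> real" where "e m = (if m < 1 then 1 else 0)" for m
  define e' where "e' m = e m - (case m of 0 \<Rightarrow> 0 | Suc l \<Rightarrow> e l)" for m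
  obtain M where M: "M > 0" "\<And>n N. 1 \<le> n \<Longrightarrow> (\<Sum>m<N. \<bar>?D (r n) m\<bar> * ?k m) \<le> M"
    using weighted_norm_tail_bounded[OF assms(1,3,4)] by (auto simp: r_def)
  obtain E where E: "\<And>N. (\<Sum>m<N. \<bar>?D e m\<bar> * ?k m) \<le> E"
    using weighted_norm_finite_support[of 1 e \<alpha>] a by (auto simp: e_def)
  have "e' m = 0" if "2 \<le> m" for m
    using that by (auto simp: e'_def e_def split: nat.split)
  then obtain E' where E': "\<And>N. (\<Sum>m<N. \<bar>?D e' m\<bar> * ?k m) \<le> E'"
    using weighted_norm_finite_support[of 2 e' \<alpha>] a by blast
  have Q: "(\<Sum>m<N. \<bar>?D (q n) m\<bar> * ?k m) \<le> 4 * (?k n * cesaro_num s n) + M / real n" if n: "1 \<le> n" for n N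
    unfolding q_def tail_coeff_self[OF n, of s, symmetric] r_def[symmetric]
  proof (rule weighted_norm_diff_le[OF a n])
    show "r n m = 0" if "m < n" for m using that by (simp add: r_def tail_coeff_def)
  qed (use M(2)[OF n] summable_tail_coeff tail_coeff_nonneg tail_coeff_decreasing tail_coeff_convex assms n
      in \<open>auto simp: r_def\<close>)
  have one: "is_disc_coeffs (\<lambda>z. 1) (\<lambda>m. of_real (e m))"
    using is_disc_coeffs_polynomial[of "\<lambda>_. 1" 1] by (simp add: e_def if_distrib cong: if_cong)
  have one': "is_disc_coeffs (\<lambda>z. 1 - z) (\<lambda>m. of_real (e' m))"
    using is_disc_coeffs_one_minus_mult[OF one] by (simp add: e'_def)
  have R: "is_disc_coeffs (\<lambda>z. 1 - g0 s n z) (\<lambda>m. of_real (r n m))" if "1 \<le> n" for n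
    using is_disc_coeffs_tail[OF assms(1,2) that] by (simp add: r_def)
  have R': "is_disc_coeffs (\<lambda>z. (1 - z) * (1 - g0 s n z)) (\<lambda>m. of_real (q n m))" if "1 \<le> n" for n
    using is_disc_coeffs_one_minus_mult[OF R[OF that]] by (simp add: q_def)
  have real_summable: "summable (\<lambda>m. \<bar>f m\<bar>)" if "is_disc_coeffs H (\<lambda>m. of_real (f m))" for H f
    using that by (simp add: is_disc_coeffs_def)
  have g: "is_disc_coeffs (g0 s n) (\<lambda>m. of_real (e m - r n m))" if "1 \<le> n" for n
    using is_disc_coeffs_diff[OF one R[OF that]] by simp
  have g': "is_disc_coeffs (\<lambda>z. (1 - z) * g0 s n z) (\<lambda>m. of_real (e' m - q n m))" if "1 \<le> n" for n
    using is_disc_coeffs_diff[OF one' R'[OF that]] by (simp add: algebra_simps)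
  have d: "is_disc_coeffs (\<lambda>z. (1 - z) * g0 s n z - (1 - z)) (\<lambda>m. of_real (- q n m))" if "1 \<le> n" for n
    using is_disc_coeffs_diff[OF g'[OF that] one'] by simp
  have "g0 s n \<in> A_disc \<alpha> \<and> A_norm \<alpha> (g0 s n) \<le> E + M" if n: "1 \<le> n" for n
    using A_disc_realI[OF a g[OF n]] A_norm_real_le[OF a g[OF n]]
      weighted_norm_triangle[OF a real_summable[OF one] real_summable[OF R[OF n]] E M(2)[OF n]]
    by blast
  moreover have "0 < E + M" using E[of 0] M(1) by simp
  moreover have "(\<lambda>z. 1 - z) \<in> A_disc \<alpha>" by (rule A_disc_realI[OF a one' E'])
  moreover have "(\<lambda>z. (1 - z) * g0 s n z) \<in> A_disc \<alpha>" if n: "1 \<le> n" for n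
    using A_disc_realI[OF a g'[OF n]]
      weighted_norm_triangle[OF a real_summable[OF one'] real_summable[OF R'[OF n]] E' Q[OF n]]
    by blast
  moreover have "(\<lambda>n. A_norm \<alpha> (\<lambda>z. (1 - z) * g0 s n z - (1 - z))) \<longlonglongrightarrow> 0"
  proof -
    \<comment> \<open>The jump term is dominated by a multiple of k^(\<alpha>+s)(n), which tends to
      0 because 0 < \<alpha> + s < 1.\<close>
    obtain C where C: "C > 0" "\<And>n. ?k n * cesaro_num s n \<le> C * cesaro_num (\<alpha> + s) n"
      using cesaro_num_mult_le[of "1 + \<alpha>" s] assms by auto
    have bound: "(\<Sum>m<N. \<bar>?D (\<lambda>m. - q n m) m\<bar> * ?k m) \<le> 4 * (C * cesaro_num (\<alpha> + s) n) + M / real n"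
      if n: "1 \<le> n" for n N
      using Q[OF n, of N] C(2)[of n] by (simp add: frac_diff_uminus[OF a real_summable[OF R'[OF n]]])
    have lim: "(\<lambda>n. 4 * (C * cesaro_num (\<alpha> + s) n) + M / real n) \<longlonglongrightarrow> 0"
    proof -
      have "(\<lambda>n. 4 * (C * cesaro_num (\<alpha> + s) n) + M / real n) \<longlonglongrightarrow> 4 * (C * 0) + 0"
        by (intro tendsto_intros cesaro_num_tendsto_0 lim_const_over_n) (use assms in auto)
      then show ?thesis by simp
    qed
    show ?thesis
    proof (rule tendsto_sandwich[OF _ _ tendsto_const lim])
      show "\<forall>\<^sub>F n in sequentially. 0 \<le> A_norm \<alpha> (\<lambda>z. (1 - z) * g0 s n z - (1 - z))"
        using eventually_ge_at_top[of 1]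
        by eventually_elim (rule A_norm_real_nonneg[OF a d bound])
      show "\<forall>\<^sub>F n in sequentially. A_norm \<alpha> (\<lambda>z. (1 - z) * g0 s n z - (1 - z))
          \<le> 4 * (C * cesaro_num (\<alpha> + s) n) + M / real n"
        using eventually_ge_at_top[of 1]
        by eventually_elim (rule A_norm_real_le[OF a d bound])
    qed
  qed
  ultimately show ?thesis by blast
qed

end
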